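(* Let $m\ge 1$ be a natural number and let $\mathcal{C}$ be an $m$-chord diagram on $\mathbb{S}^1$. Then $\mathrm{arc}(\mathcal{C})=2$ if and only if, for every natural number $n\ge 1$, no sub-chord diagram of $\mathcal{C}$ is equivalent to the chord diagram $\mathcal{C}_{2n+1}$.
   Context: Natural numbers are positive integers. $\mathbb{S}^1$ is the unit circle in $\mathbb{R}^2$. Arc number of a map: Let $X$ be a set and $f:\mathbb{S}^1\to X$ a map. For a natural number $n>1$, $f$ can be divided into $n$ arc embeddings if there are $n$ subspaces $I_1,\dots,I_n$ of $\mathbb{S}^1$, each homeomorphic to a closed interval, with $\mathbb{S}^1=I_1\cup\cdots\cup I_n$ and $f|_{I_i}$ injective for each $i$. If $f$ is injective then $\mathrm{arc}(f)=1$; otherwise $\mathrm{arc}(f)$ is the smallest such $n$, and $\mathrm{arc}(f)=\infty$ if no such $n$ exists. Chord diagrams: For a natural number $m\ge 1$, an $m$-chord diagram on $\mathbb{S}^1$ is a pair $\mathcal{C}=(P,\varphi)$ where $P\subset\mathbb{S}^1$ contains exactly $2m$ points and $\varphi$ is a fixed point free involution on $P$. A chord of $\mathcal{C}$ is an unordered pair $(x,\varphi(x))=(\varphi(x),x)$ with $x\in P$. A chord diagram is an $m$-chord diagram for some $m\ge1$. Let $\sim_{\mathcal{C}}$ be the equivalence relation on $\mathbb{S}^1$ generated by $x\sim_{\mathcal{C}}\varphi(x)$ for $x\in P$, and $f_{\mathcal{C}}:\mathbb{S}^1\to\mathbb{S}^1/\!\sim_{\mathcal{C}}$ the quotient map;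 $\mathrm{arc}(\mathcal{C})$ is defined to be $\mathrm{arc}(f_{\mathcal{C}})$. Two $m$-chord diagrams $(P_1,\varphi_1)$ and $(P_2,\varphi_2)$ are equivalent if there is an orientation preserving self-homeomorphism $h$ of $\mathbb{S}^1$ with $h(P_1)=P_2$ and $h\circ\varphi_1=\varphi_2\circ h$ on $P_1$. A chord diagram $(Q,\psi)$ is a sub-chord diagram of $(P,\varphi)$ if $Q\subset P$ and $\psi$ is the restriction of $\varphi$ to $Q$. The chord diagram $\mathcal{C}_{2n+1}$ ($n\ge 1$): For $k>2$ let $v_{k;1},\dots,v_{k;k}$ be the vertices of a regular $k$-gon inscribed in $\mathbb{S}^1$, in counterclockwise order, indices modulo $k$. For a natural number $j<k/2$, let $c(k;i,j)$ be the chord joining $v_{k;i}$ and $v_{k;i+j}$. Then $\mathcal{C}_{2n+1}$ is the $(2n+1)$-chord diagram whose chords are $c(4n+2;2i-1,2n-1)$ for $i\in\{1,\dots,2n+1\}$, i.e. the chords joining $v_{4n+2;2i-1}$ and $v_{4n+2;2i+2n-2}$. *)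

theory Defs
  imports "HOL-Analysis.Analysis" "HOL-Library.Extended_Nat"
begin

abbreviation S1 :: "complex set"
  where "S1 \<equiv> sphere 0 1"

definition divides_into_arc_embeddings :: "(complex \<Rightarrow> 'a) \<Rightarrow> nat \<Rightarrow> bool"
  where "divides_into_arc_embeddings f n \<longleftrightarrow>
    (\<exists>I :: nat \<Rightarrow> complex set.
      (\<forall>i\<in>{1..n}. I i \<subseteq> S1 \<and> I i homeomorphic {0..1::real} \<and> inj_on f (I i)) \<and>
      S1 = (\<Union>i\<in>{1..n}. I i))"

text \<open>The arc number of the restriction of \<open>f\<close> to the circle. The infimum of a nonempty
  set of extended naturals is its least element, and the infimum of the empty set is \<open>\<infinity>\<close>.\<close>

definition arc_number :: "(complex \<Rightarrow> 'a) \<Rightarrow> enat"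
  where "arc_number f =
    (if inj_on f S1 then 1
     else Inf {enat n |n. 1 < n \<and> divides_into_arc_embeddings f n})"

text \<open>A chord diagram is a pair \<open>(P, \<phi>)\<close>; the values of \<open>\<phi>\<close> outside \<open>P\<close> are irrelevant.\<close>

type_synonym diagram = "complex set \<times> (complex \<Rightarrow> complex)"

definition is_chord_diagram :: "nat \<Rightarrow> diagram \<Rightarrow> bool"
  where "is_chord_diagram m = (\<lambda>(P, \<phi>).
    m \<ge> 1 \<and> P \<subseteq> S1 \<and> finite P \<and> card P = 2 * m \<and>
    (\<forall>x\<in>P. \<phi> x \<in> P \<and> \<phi> x \<noteq> x \<and> \<phi> (\<phi> x) = x))"

definition chord_equiv :: "diagram \<Rightarrow> (complex \<times> complex) set"
  where "chord_equiv = (\<lambda>(P, \<phi>).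
    {(x, y). x \<in> S1 \<and> y \<in> S1 \<and> equivclp (\<lambda>u v. u \<in> P \<and> v = \<phi> u) x y})"

text \<open>On \<open>S1\<close>, this is the projection onto the quotient \<open>S1 // chord_equiv C\<close>.\<close>

definition quotient_map_of :: "diagram \<Rightarrow> complex \<Rightarrow> complex set"
  where "quotient_map_of C x = chord_equiv C `` {x}"

definition diagram_arc_number :: "diagram \<Rightarrow> enat"
  where "diagram_arc_number C = arc_number (quotient_map_of C)"

text \<open>A self-homeomorphism of the circle preserves orientation iff its lifts to the universal
  cover \<open>cis\<close> are increasing. Lifts differ by constants, so it does not matter which one is
  taken.\<close>

definition orientation_preserving_homeo :: "(complex \<Rightarrow> complex) \<Rightarrow> bool"
  where "orientation_preserving_homeo h \<longleftrightarrow>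
    (\<exists>k. homeomorphism S1 S1 h k) \<and>
    (\<exists>g :: real \<Rightarrow> real. continuous_on UNIV g \<and> strict_mono g \<and> (\<forall>t. h (cis t) = cis (g t)))"

definition equivalent_diagrams :: "diagram \<Rightarrow> diagram \<Rightarrow> bool"
  where "equivalent_diagrams = (\<lambda>(P\<^sub>1, \<phi>\<^sub>1) (P\<^sub>2, \<phi>\<^sub>2).
    (\<exists>h. orientation_preserving_homeo h \<and> h ` P\<^sub>1 = P\<^sub>2 \<and> (\<forall>x\<in>P\<^sub>1. h (\<phi>\<^sub>1 x) = \<phi>\<^sub>2 (h x))))"

definition sub_diagram :: "diagram \<Rightarrow> diagram \<Rightarrow> bool"
  where "sub_diagram = (\<lambda>(Q, \<psi>) (P, \<phi>).
    (\<exists>m. is_chord_diagram m (Q, \<psi>)) \<and> Q \<subseteq> P \<and> (\<forall>x\<in>Q. \<psi> x = \<phi> x))"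

definition polygon_vertex :: "nat \<Rightarrow> nat \<Rightarrow> complex"
  where "polygon_vertex k i = cis (2 * pi * real i / real k)"

definition polygon_chord :: "nat \<Rightarrow> nat \<Rightarrow> nat \<Rightarrow> complex set"
  where "polygon_chord k i j = {polygon_vertex k i, polygon_vertex k (i + j)}"

text \<open>The diagram with a given set of pairwise disjoint chords, each a two-element set.\<close>

definition diagram_of_chords :: "complex set set \<Rightarrow> diagram"
  where "diagram_of_chords K = (\<Union>K, \<lambda>x. THE y. {x, y} \<in> K)"

text \<open>For \<open>n \<ge> 1\<close>, \<open>odd_diagram n\<close> is the diagram with \<open>2 * n + 1\<close> chords usually written
  \<open>C\<^sub>2\<^sub>n\<^sub>+\<^sub>1\<close>.\<close>

definition odd_diagram :: "nat \<Rightarrow> diagram"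
  where "odd_diagram n = diagram_of_chords
    {polygon_chord (4 * n + 2) (2 * i - 1) (2 * n - 1) |i. i \<in> {1..2 * n + 1}}"

lemma polygon_vertex_eq_iff:
  assumes "k > 0"
  shows "polygon_vertex k i = polygon_vertex k j \<longleftrightarrow> i mod k = j mod k"
proof -
  have "polygon_vertex k i = polygon_vertex k j \<longleftrightarrow>
      (\<exists>z::int. 2 * pi * real i / real k = 2 * pi * real j / real k + 2 * pi * of_int z)"
    unfolding polygon_vertex_def using sin_cos_eq_iff by (auto simp: complex_eq_iff)
  also have "\<dots> \<longleftrightarrow> (\<exists>z::int. int i = int j + int k * z)"
  proof (rule arg_cong[where f = Ex], rule ext)
    fix z :: int
    have "2 * pi * real i / real k = 2 * pi * real j / real k + 2 * pi * of_int z
        \<longleftrightarrow> (2 * pi / real k) * real i = (2 * pi / real k) * (real j + real k * of_int z)"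
      using assms by (simp add: distrib_left mult.assoc)
    also have "\<dots> \<longleftrightarrow> real i = real j + real k * of_int z"
      using assms by (subst mult_cancel_left) simp
    also have "\<dots> \<longleftrightarrow> real_of_int (int i) = real_of_int (int j + int k * z)"
      by simp
    finally have "2 * pi * real i / real k = 2 * pi * real j / real k + 2 * pi * of_int z
        \<longleftrightarrow> real_of_int (int i) = real_of_int (int j + int k * z)" .
    then show "(2 * pi * real i / real k = 2 * pi * real j / real k + 2 * pi * of_int z)
        = (int i = int j + int k * z)"
      by (simp only: of_int_eq_iff)
  qed
  also have "\<dots> \<longleftrightarrow> int i mod int k = int j mod int k"
    by (auto simp: mod_eq_dvd_iff dvd_def algebra_simps)
  also have "\<dots> \<longleftrightarrow> i mod k = j mod k"
    by (simp flip: zmod_int)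
  finally show ?thesis .
qed

lemma is_chord_diagram_odd_diagram:
  assumes n: "n \<ge> 1"
  shows "is_chord_diagram (2 * n + 1) (odd_diagram n)"
proof -
  define k where "k = 4 * n + 2"
  define J where "J = {1..2 * n + 1}"
  define a where "a i = polygon_vertex k (2 * i - 1)" for i
  define b where "b i = polygon_vertex k (2 * i - 1 + (2 * n - 1))" for i
  define K where "K = {{a i, b i} |i. i \<in> J}"
  have k: "k > 0" by (simp add: k_def)
  have odd_eq: "odd_diagram n = (\<Union>K, \<lambda>x. THE y. {x, y} \<in> K)"
    by (simp add: odd_diagram_def diagram_of_chords_def K_def J_def polygon_chord_def a_def b_def k_def)
  have inja: "inj_on a J"
    unfolding inj_on_def a_def polygon_vertex_eq_iff[OF k] by (auto simp: J_def k_def)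
  have injb: "inj_on b J"
  proof -
    have "b i = a i * polygon_vertex k (2 * n - 1)" for i
      unfolding a_def b_def polygon_vertex_def cis_mult by (simp add: add_divide_distrib distrib_left)
    then show ?thesis
      using inja by (auto simp: inj_on_def polygon_vertex_def)
  qed
  have ab: "a i \<noteq> b j" if "i \<in> J" "j \<in> J" for i j
  proof
    assume "a i = b j"
    then have "(2 * i - 1) mod k = (2 * j - 1 + (2 * n - 1)) mod k"
      by (simp add: a_def b_def polygon_vertex_eq_iff[OF k])
    moreover have "even k" by (simp add: k_def)
    ultimately have "even (2 * i - 1) = even (2 * j - 1 + (2 * n - 1))"
      by (metis dvd_mod_iff)
    then show False using that n by (auto simp: J_def)
  qed
  have pa: "(THE y. {a i, y} \<in> K) = b i" if "i \<in> J" for i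
    by (rule the_equality) (use that ab inja in \<open>auto simp: K_def doubleton_eq_iff dest: inj_onD\<close>)
  have pb: "(THE y. {b i, y} \<in> K) = a i" if "i \<in> J" for i
    by (rule the_equality) (use that ab ab[THEN not_sym] injb in \<open>auto simp: K_def doubleton_eq_iff dest: inj_onD\<close>)
  have UK: "\<Union>K = a ` J \<union> b ` J" by (auto simp: K_def)
  have "card (\<Union>K) = 2 * (2 * n + 1)"
    unfolding UK using ab inja injb
    by (subst card_Un_disjoint) (auto simp: card_image J_def)
  moreover have "\<Union>K \<subseteq> S1"
    by (auto simp: UK a_def b_def polygon_vertex_def)
  moreover have "finite (\<Union>K)" by (simp add: UK J_def)
  ultimately show ?thesis
    unfolding odd_eq is_chord_diagram_def
    by (auto simp: UK pa pb ab ab[THEN not_sym])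
qed

end

theory Submission
  imports Defs
begin

text \<open>Two arcs suffice iff two points cut the circle so that every chord joins the two sides. If this
  fails, then from every point one meets two consecutive disjoint chords within one turn. Iterating, the
  pigeonhole principle yields a cyclic chain of \<open>2n + 1\<close> consecutive disjoint chords that winds at
  most \<open>n\<close> times around the circle. When \<open>n\<close> is minimal, no two adjacent chords of the chain can be
  dropped; this forces the cyclic order of the end points to be that of \<open>C\<^sub>2\<^sub>n\<^sub>+\<^sub>1\<close>. Conversely,
  of \<open>2n + 1\<close> consecutive vertices of the regular \<open>(4n + 2)\<close>-gon, some two are joined by a chord
  of \<open>C\<^sub>2\<^sub>n\<^sub>+\<^sub>1\<close>, and any two arcs covering the circle include such a run in one of them.\<close>

section \<open>Lifts of circle maps\<close>

lemma cis_eq_cis_iff: "cis s = cis t \<longleftrightarrow> (\<exists>k::int. s = t + 2 * pi * of_int k)"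
  using sin_cos_eq_iff[of s t] by (auto simp: complex_eq_iff)

lemma cis_add_int [simp]: "cis (t + 2 * pi * of_int k) = cis t"
  by (auto simp: cis_eq_cis_iff)

lemma cis_eq_imp_eq:
  assumes "cis s = cis t" "\<bar>s - t\<bar> < 2 * pi"
  shows "s = t"
proof -
  obtain k :: int where k: "s = t + 2 * pi * of_int k"
    using assms(1) cis_eq_cis_iff by blast
  then have "2 * pi * \<bar>of_int k\<bar> < 2 * pi * 1"
    using assms(2) by (simp add: abs_mult)
  then have "\<bar>of_int k :: real\<bar> < 1"
    by (subst (asm) mult_less_cancel_left_pos) auto
  then have "k = 0" by linarith
  with k show ?thesis by simp
qed

lemma cis_Arg2pi: "norm z = 1 \<Longrightarrow> cis (Arg2pi z) = z"
  using Arg2pi[of z] by (simp add: is_Arg_def cis_conv_exp)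

lemma S1_eq_range_cis: "S1 = range cis"
  using cis_Arg2pi by (auto simp: image_iff) (metis)

lemma periodic_int:
  fixes f :: "real \<Rightarrow> real"
  assumes "\<And>t. f (t + a) = f t + b"
  shows "f (t + a * of_int k) = f t + b * of_int k"
proof (induction k rule: int_induct[where k = 0])
  case (step1 i)
  show ?case using step1.IH assms[of "t + a * of_int i"] by (simp add: algebra_simps)
next
  case (step2 i)
  show ?case using step2.IH assms[of "t + a * of_int (i - 1)"] by (simp add: algebra_simps)
qed simp

text \<open>By periodicity \<open>g\<close> respects the fibres of \<open>cis\<close> and descends
  to the circle; since one turn goes to exactly one turn, the induced map is injective.\<close>

lemma orientation_preserving_homeo_of_lift:
  fixes g :: "real \<Rightarrow> real"
  assumes mono: "strict_mono g" and surj: "surj g" and per: "\<And>t. g (t + 2 * pi) = g t + 2 * pi"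
  obtains h where "orientation_preserving_homeo h" "\<And>t. h (cis t) = cis (g t)"
proof
  define h where "h z = cis (g (Arg2pi z))" for z
  have perk: "g (t + 2 * pi * of_int k) = g t + 2 * pi * of_int k" for t k
    using periodic_int[of g, OF per] .
  show hc: "h (cis t) = cis (g t)" for t
  proof -
    have "cis (Arg2pi (cis t)) = cis t" by (simp add: cis_Arg2pi)
    then obtain k where "Arg2pi (cis t) = t + 2 * pi * of_int k"
      using cis_eq_cis_iff by blast
    then show ?thesis by (simp add: h_def perk)
  qed
  have contg: "continuous_on UNIV g"
    using surj mono by (intro continuous_onI_mono) (auto simp: strict_mono_less_eq)
  have "h ` S1 = range (\<lambda>t. cis (g t))"
    by (simp add: S1_eq_range_cis image_image hc)
  also have "\<dots> = cis ` range g" by auto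
  also have "\<dots> = S1" by (simp add: surj S1_eq_range_cis)
  finally have im: "h ` S1 = S1" .
  have inj: "inj_on h S1"
  proof (rule inj_onI)
    fix x y assume "x \<in> S1" "y \<in> S1" and eq: "h x = h y"
    then obtain s t where st: "x = cis s" "y = cis t" unfolding S1_eq_range_cis by auto
    with eq have "cis (g s) = cis (g t)" by (simp add: hc)
    then obtain k where "g s = g (t + 2 * pi * of_int k)"
      using cis_eq_cis_iff perk by metis
    then have "s = t + 2 * pi * of_int k"
      using strict_mono_eq[OF mono] by blast
    with st show "x = y" by simp
  qed
  \<comment> \<open>The preimage of a closed set under \<open>h\<close> is the \<open>cis\<close>
    image of a compact part of one turn, so continuity passes down from \<open>g\<close>.\<close>
  have "continuous_on S1 h"
  proof (subst continuous_on_closed_vimage, simp, intro allI impI)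
    fix B :: "complex set" assume B: "closed B"
    have "continuous_on UNIV (\<lambda>t. cis (g t))"
      unfolding cis_conv_exp using contg by (intro continuous_intros)
    then have "closed ((\<lambda>t. cis (g t)) -` B)"
      using B by (auto simp: continuous_on_closed_vimage)
    then have "compact ((\<lambda>t. cis (g t)) -` B \<inter> {0..2 * pi})"
      by (intro closed_Int_compact) auto
    then have "compact (cis ` ((\<lambda>t. cis (g t)) -` B \<inter> {0..2 * pi}))"
      by (intro compact_continuous_image) (auto simp: cis_conv_exp intro!: continuous_intros)
    moreover have "h -` B \<inter> S1 = cis ` ((\<lambda>t. cis (g t)) -` B \<inter> {0..2 * pi})"
    proof (intro equalityI subsetI)
      fix z assume z: "z \<in> h -` B \<inter> S1"
      then have c: "cis (Arg2pi z) = z" by (simp add: cis_Arg2pi)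
      have "Arg2pi z \<in> (\<lambda>t. cis (g t)) -` B \<inter> {0..2 * pi}"
        using z Arg2pi[of z] by (simp add: h_def)
      then show "z \<in> cis ` ((\<lambda>t. cis (g t)) -` B \<inter> {0..2 * pi})"
        using c by (metis imageI)
    qed (auto simp: hc)
    ultimately show "closed (h -` B \<inter> S1)"
      by (simp add: compact_imp_closed)
  qed
  then obtain k where "homeomorphism S1 S1 h k"
    using homeomorphism_compact[OF _ _ im inj] by auto
  then show "orientation_preserving_homeo h"
    unfolding orientation_preserving_homeo_def using contg mono hc by blast
qed

section \<open>Interpolation of periodic increasing sequences\<close>

lemma increasing_int:
  fixes u :: "int \<Rightarrow> real"
  assumes "\<And>k. u k < u (k + 1)"
  shows "i < j \<Longrightarrow> u i < u j"
proof (induction j rule: int_gr_induct)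
  case base
  show ?case using assms by simp
next
  case (step j)
  then show ?case using assms[of j] by linarith
qed

lemma ex_int_bracket:
  fixes u :: "int \<Rightarrow> real"
  assumes mono: "\<And>k. u k < u (k + 1)"
    and per: "\<And>k. u (k + M) = u k + a" and a: "a > 0"
  shows "\<exists>k. u k \<le> t \<and> t < u (k + 1)"
proof -
  have perj: "u (M * j) = u 0 + a * of_int j" for j
  proof (induction j rule: int_induct[where k = 0])
    case (step1 i)
    then show ?case using per[of "M * i"] by (simp add: algebra_simps)
  next
    case (step2 i)
    then show ?case using per[of "M * (i - 1)"] by (simp add: algebra_simps)
  qed simp
  define q where "q = \<lfloor>(t - u 0) / a\<rfloor>"
  have "of_int q \<le> (t - u 0) / a" "(t - u 0) / a < of_int q + 1"
    unfolding q_def by linarith+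
  then have lo: "u (M * q) \<le> t" and hi: "t < u (M * (q + 1))"
    unfolding perj using a by (simp_all add: field_simps)
  \<comment> \<open>Positivity of \<open>M\<close> comes from monotonicity and
    \<open>a > 0\<close>.\<close>
  have "M * q < M * (q + 1)"
  proof (rule ccontr)
    assume "\<not> ?thesis"
    then have "u (M * (q + 1)) \<le> u (M * q)"
      using increasing_int[of u, OF mono] by (metis less_eq_real_def linorder_less_linear)
    with lo hi show False by linarith
  qed
  define S where "S = {k \<in> {M * q..M * (q + 1)}. u k \<le> t}"
  have fin: "finite S" unfolding S_def by (rule finite_subset[of _ "{M * q..M * (q + 1)}"]) auto
  have ne: "M * q \<in> S" using lo \<open>M * q < M * (q + 1)\<close> by (simp add: S_def)
  define k where "k = Max S"
  have "k \<in> S" unfolding k_def using fin ne by (intro Max_in) auto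
  then have k: "u k \<le> t" "M * q \<le> k" "k \<le> M * (q + 1)" by (auto simp: S_def)
  with hi have "k \<noteq> M * (q + 1)" by auto
  with k have kle: "k + 1 \<le> M * (q + 1)" by linarith
  have "k + 1 \<notin> S" using Max_ge[OF fin, of "k + 1"] by (auto simp: k_def)
  then have "t < u (k + 1)" using k kle by (auto simp: S_def)
  with k show ?thesis by blast
qed

text \<open>Interpolating linearly between consecutive integers gives a change of parameter that
  commutes with the periods, hence later a circle homeomorphism carrying chord ends to polygon
  vertices.\<close>

lemma interpolation:
  fixes u :: "int \<Rightarrow> real"
  assumes mono: "\<And>k. u k < u (k + 1)"
    and per: "\<And>k. u (k + M) = u k + a" and a: "a > 0"
  obtains G :: "real \<Rightarrow> real" where "strict_mono G" "surj G"
    "\<And>k. G (of_int k) = u k" "\<And>y. G (y + of_int M) = G y + a"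
proof
  define G where "G y = u \<lfloor>y\<rfloor> + frac y * (u (\<lfloor>y\<rfloor> + 1) - u \<lfloor>y\<rfloor>)" for y :: real
  show "G (of_int k) = u k" for k by (simp add: G_def)
  show "G (y + of_int M) = G y + a" for y
  proof -
    have "\<lfloor>y + of_int M\<rfloor> = \<lfloor>y\<rfloor> + M" by simp
    moreover have "frac (y + of_int M) = frac y" by (simp add: frac_def)
    moreover have "u (\<lfloor>y\<rfloor> + M + 1) = u (\<lfloor>y\<rfloor> + 1) + a"
      using per[of "\<lfloor>y\<rfloor> + 1"] by (simp add: algebra_simps)
    ultimately show ?thesis by (simp add: G_def per)
  qed
  have lower: "u \<lfloor>y\<rfloor> \<le> G y" for y
    unfolding G_def using mono[of "\<lfloor>y\<rfloor>"] frac_ge_0[of y] by simp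
  have upper: "G y < u (\<lfloor>y\<rfloor> + 1)" for y
  proof -
    have "frac y * (u (\<lfloor>y\<rfloor> + 1) - u \<lfloor>y\<rfloor>) < 1 * (u (\<lfloor>y\<rfloor> + 1) - u \<lfloor>y\<rfloor>)"
      using mono[of "\<lfloor>y\<rfloor>"] frac_lt_1[of y] by (intro mult_strict_right_mono) auto
    then show ?thesis by (simp add: G_def)
  qed
  show "strict_mono G"
  proof (rule strict_monoI)
    fix x y :: real assume xy: "x < y"
    then have le: "\<lfloor>x\<rfloor> \<le> \<lfloor>y\<rfloor>" by (simp add: floor_mono)
    show "G x < G y"
    proof (cases "\<lfloor>x\<rfloor> = \<lfloor>y\<rfloor>")
      case True
      then have "frac x < frac y" using xy by (simp add: frac_def)
      then show ?thesis using mono[of "\<lfloor>y\<rfloor>"] by (simp add: G_def True)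
    next
      case False
      then have "\<lfloor>x\<rfloor> + 1 \<le> \<lfloor>y\<rfloor>" using le by simp
      then have "u (\<lfloor>x\<rfloor> + 1) \<le> u \<lfloor>y\<rfloor>"
        using increasing_int[of u, OF mono] by (metis less_eq_real_def order_le_less)
      then show ?thesis using upper[of x] lower[of y] by linarith
    qed
  qed
  show "surj G"
  proof (rule surjI[of _ "\<lambda>t. SOME y. G y = t"], rule someI_ex)
    fix t
    obtain k where k: "u k \<le> t" "t < u (k + 1)"
      using ex_int_bracket[of u, OF mono per a] by blast
    define r where "r = (t - u k) / (u (k + 1) - u k)"
    have r: "0 \<le> r" "r < 1" "r * (u (k + 1) - u k) = t - u k"
      using k mono[of k] by (auto simp: r_def)
    then have fl: "\<lfloor>of_int k + r\<rfloor> = k" by linarith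
    then have "frac (of_int k + r) = r" by (simp add: frac_def)
    with fl r show "\<exists>y. G y = t" by (intro exI[of _ "of_int k + r"]) (simp add: G_def)
  qed
qed

section \<open>The diagrams with an odd number of chords\<close>

text \<open>Cut the circle at \<open>cis \<theta>\<close>. On the rest the angle counted from
  \<open>\<theta>\<close> is continuous, so it maps the connected set \<open>X\<close> onto an
  interval.\<close>

lemma connected_arc_between:
  assumes X: "connected X" "X \<subseteq> S1" and \<theta>: "cis \<theta> \<notin> X"
    and r: "cis r \<in> X" "\<theta> < r" and t: "cis t \<in> X" "t < \<theta> + 2 * pi"
    and s: "r \<le> s" "s \<le> t"
  shows "cis s \<in> X"
proof -
  define f where "f z = \<theta> + Arg2pi (z / cis \<theta>)" for z
  have f_cis: "f (cis x) = x" if "\<theta> < x" "x < \<theta> + 2 * pi" for x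
  proof -
    have "cis (Arg2pi (cis (x - \<theta>))) = cis (x - \<theta>)" by (simp add: cis_Arg2pi)
    then have "Arg2pi (cis (x - \<theta>)) = x - \<theta>"
      using that Arg2pi[of "cis (x - \<theta>)"] by (intro cis_eq_imp_eq) auto
    then show ?thesis by (simp add: f_def cis_divide)
  qed
  have cis_f: "cis (f z) = z" if "z \<in> X" for z
    using that X(2) by (auto simp: f_def cis_Arg2pi norm_divide simp flip: cis_mult)
  have "continuous_on X f"
  proof (rule continuous_at_imp_continuous_on, rule ballI)
    fix z assume z: "z \<in> X"
    have "z / cis \<theta> \<notin> \<real>\<^sub>\<ge>\<^sub>0"
    proof
      assume "z / cis \<theta> \<in> \<real>\<^sub>\<ge>\<^sub>0"
      then obtain r where r: "z / cis \<theta> = of_real r" "r \<ge> 0" by (rule nonneg_Reals_cases)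
      have "norm (z / cis \<theta>) = 1" using z X(2) by (auto simp: norm_divide)
      with r have "z / cis \<theta> = 1" by simp
      then show False using z \<theta> by (auto simp: divide_eq_1_iff)
    qed
    then have "isCont (\<lambda>w. Arg2pi (w / cis \<theta>)) z"
      by (intro isCont_o2[of z "\<lambda>w. w / cis \<theta>" Arg2pi] continuous_at_Arg2pi continuous_intros) auto
    then show "isCont f z" unfolding f_def by (intro continuous_intros)
  qed
  then have "connected (f ` X)" using X(1) by (rule connected_continuous_image)
  moreover have "r \<in> f ` X" "t \<in> f ` X"
    using r t s f_cis[of r] f_cis[of t] by (force simp: image_iff)+
  ultimately have "s \<in> f ` X"
    using s by (meson connected_contains_Icc atLeastAtMost_iff subsetD)
  then show ?thesis using cis_f by auto
qed

text \<open>These are the values of \<open>polygon_vertex (4 * n + 2)\<close>; integer indices allow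
  stepping backwards without truncated subtraction.\<close>

definition vertex :: "nat \<Rightarrow> int \<Rightarrow> complex"
  where "vertex n j = cis (2 * pi * of_int j / of_int (4 * int n + 2))"

lemma vertex_eq_iff: "vertex n i = vertex n j \<longleftrightarrow> (\<exists>k. i = j + (4 * int n + 2) * k)"
proof -
  define M where "M = 4 * int n + 2"
  have M: "real_of_int M > 0" by (simp add: M_def)
  have "2 * pi * of_int i / of_int M = 2 * pi * of_int j / of_int M + 2 * pi * of_int k
      \<longleftrightarrow> i = j + M * k" for k
  proof -
    have "2 * pi * of_int i / of_int M = 2 * pi * of_int j / of_int M + 2 * pi * of_int k
        \<longleftrightarrow> (2 * pi / of_int M) * of_int i = (2 * pi / of_int M) * (of_int j + of_int M * of_int k)"
      using M by (simp add: field_simps)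
    also have "\<dots> \<longleftrightarrow> real_of_int i = of_int j + of_int M * of_int k"
      using M by (subst mult_cancel_left) auto
    also have "\<dots> \<longleftrightarrow> real_of_int i = of_int (j + M * k)" by simp
    finally show ?thesis by (simp only: of_int_eq_iff)
  qed
  then show ?thesis by (simp add: vertex_def cis_eq_cis_iff flip: M_def)
qed

text \<open>The number of vertices is even, so the parity of the index belongs to the vertex itself.
  It tells the two ends of a chord of \<open>odd_diagram n\<close> apart.\<close>

lemma vertex_eq_parity:
  assumes "vertex n i = vertex n j"
  shows "even i = even j"
proof -
  obtain k where "i = j + (4 * int n + 2) * k" using assms vertex_eq_iff by blast
  then show ?thesis by simp
qed

lemma vertex_add_eq: "vertex n i = vertex n j \<Longrightarrow> vertex n (i + d) = vertex n (j + d)"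
  unfolding vertex_eq_iff by (elim ex_forward) simp

text \<open>In a turn starting at a point outside \<open>X\<close>, the vertices in \<open>X\<close>
  have consecutive indices. If there are at most \<open>2 * n\<close> of them, the others, at least
  \<open>2 * n + 2\<close>, are consecutive on the circle.\<close>

lemma half_of_vertices:
  assumes X: "connected X" "X \<subseteq> S1" "X \<noteq> S1"
  obtains x where
    "(\<forall>j\<in>{x..x + 2 * int n}. vertex n j \<in> X) \<or> (\<forall>j\<in>{x..x + 2 * int n}. vertex n j \<notin> X)"
proof -
  define M where "M = 4 * int n + 2"
  have M: "real_of_int M > 0" by (simp add: M_def)
  define a where "a j = 2 * pi * of_int j / of_int M" for j
  have v: "vertex n j = cis (a j)" for j by (simp add: vertex_def a_def M_def)
  have a_mono: "a i \<le> a j \<longleftrightarrow> i \<le> j" for i j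
    using M by (simp add: a_def divide_le_cancel)
  obtain \<theta> where \<theta>: "cis \<theta> \<notin> X" 
    using X(2,3) unfolding S1_eq_range_cis by blast
  \<comment> \<open>The first index whose angle is not below \<open>\<theta>\<close>; the turn from
    \<open>\<theta>\<close> then has the indices \<open>c\<close> to
    \<open>c + M - 1\<close>.\<close>
  define c where "c = \<lceil>\<theta> * M / (2 * pi)\<rceil>"
  have lo: "\<theta> \<le> a j" if "c \<le> j" for j
  proof -
    have "\<theta> * M / (2 * pi) \<le> j" using that by (simp add: c_def ceiling_le_iff)
    then show ?thesis using M by (simp add: a_def field_simps)
  qed
  have hi: "a j < \<theta> + 2 * pi" if "j < c + M" for j
  proof -
    have "of_int (j - M) < \<theta> * M / (2 * pi)" using that unfolding c_def by linarith
    then show ?thesis using M by (simp add: a_def field_simps)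
  qed
  define T where "T = {j. c \<le> j \<and> j < c + M \<and> vertex n j \<in> X}"
  show ?thesis
  proof (cases "T = {}")
    case True
    then show ?thesis by (intro that[of c]) (auto simp: T_def M_def)
  next
    case False
    have fin: "finite T" unfolding T_def by (rule finite_subset[of _ "{c..c + M}"]) auto
    define p q where "p = Min T" and "q = Max T"
    have p: "p \<in> T" and q: "q \<in> T" using fin False by (auto simp: p_def q_def)
    have pq: "p \<le> j" "j \<le> q" if "j \<in> T" for j using fin that by (auto simp: p_def q_def)
    have inX: "vertex n j \<in> X" if "p \<le> j" "j \<le> q" for j
      unfolding v
    proof (rule connected_arc_between[OF X(1,2) \<theta>, of "a p" "a q"])
      show "cis (a p) \<in> X" "cis (a q) \<in> X" using p q by (auto simp: T_def v)
      then show "\<theta> < a p" using lo[of p] p \<theta> by (cases "\<theta> = a p") (auto simp: T_def)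
      show "a q < \<theta> + 2 * pi" using hi q by (auto simp: T_def)
    qed (use that in \<open>auto simp: a_mono\<close>)
    show ?thesis
    proof (cases "q - p \<ge> 2 * int n")
      case True
      then show ?thesis using inX by (intro that[of p]) auto
    next
      case False
      \<comment> \<open>This run may pass the cut at \<open>\<theta>\<close>; moved back by
        \<open>M\<close>, an index past it falls below \<open>p\<close>, because
        \<open>q - p < 2 * n\<close>.\<close>
      have "vertex n j \<notin> X" if j: "q + 1 \<le> j" "j \<le> q + 1 + 2 * int n" for j
      proof (cases "j < c + M")
        case True
        then have "j \<notin> T" using pq(2)[of j] j by auto
        then show ?thesis using True j q by (auto simp: T_def)
      next
        case ge: False
        have "j - M \<notin> T" using pq(1)[of "j - M"] j False by (auto simp: M_def)
        then have "vertex n (j - M) \<notin> X" using ge j q by (auto simp: T_def M_def)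
        moreover have "vertex n (j - M) = vertex n j"
          unfolding vertex_eq_iff by (intro exI[of _ "-1"]) (simp add: M_def)
        ultimately show ?thesis by simp
      qed
      then show ?thesis by (intro that[of "q + 1"]) auto
    qed
  qed
qed

lemma odd_diagram_conv:
  assumes "n \<ge> 1"
  shows "odd_diagram n = diagram_of_chords {{vertex n j, vertex n (j + 2 * int n - 1)} |j. odd j}"
proof -
  have pv: "polygon_vertex (4 * n + 2) i = vertex n (int i)" for i
    by (simp add: polygon_vertex_def vertex_def add.commute)
  have "{polygon_chord (4 * n + 2) (2 * i - 1) (2 * n - 1) |i. i \<in> {1..2 * n + 1}}
      = {{vertex n j, vertex n (j + 2 * int n - 1)} |j. odd j}" (is "?A = ?B")
  proof (intro equalityI subsetI)
    fix c assume "c \<in> ?A"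
    then obtain i where i: "i \<in> {1..2 * n + 1}"
      and c: "c = polygon_chord (4 * n + 2) (2 * i - 1) (2 * n - 1)" by blast
    have "int (2 * i - 1 + (2 * n - 1)) = int (2 * i - 1) + 2 * int n - 1"
      using assms by (simp add: of_nat_diff)
    then have "c = {vertex n (int (2 * i - 1)), vertex n (int (2 * i - 1) + 2 * int n - 1)}"
      unfolding c polygon_chord_def pv by (simp only:)
    moreover have "odd (int (2 * i - 1))" using i by auto
    ultimately show "c \<in> ?B" by blast
  next
    fix c assume "c \<in> ?B"
    then obtain j where "odd j" and c: "c = {vertex n j, vertex n (j + 2 * int n - 1)}" by blast
    then obtain t where t: "j = 2 * t + 1" by (auto elim: oddE)
    \<comment> \<open>Odd \<open>j\<close> matter only modulo \<open>4 * n + 2\<close>, so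
      \<open>t\<close> may be reduced modulo \<open>2 * n + 1\<close>.\<close>
    define r where "r = t mod (2 * int n + 1)"
    define i where "i = nat r + 1"
    have r: "0 \<le> r" "r < 2 * int n + 1" 
      unfolding r_def by (intro pos_mod_sign pos_mod_bound; linarith)+
    have "t = r + (2 * int n + 1) * (t div (2 * int n + 1))" by (simp add: r_def)
    then have "j = (2 * r + 1) + (4 * int n + 2) * (t div (2 * int n + 1))"
      unfolding t by (simp add: algebra_simps)
    then have e: "vertex n j = vertex n (2 * r + 1)" unfolding vertex_eq_iff by blast
    from vertex_add_eq[OF e, of "2 * int n - 1"]
    have e': "vertex n (j + 2 * int n - 1) = vertex n (2 * r + 1 + 2 * int n - 1)"
      by (simp add: algebra_simps)
    have i: "int (2 * i - 1) = 2 * r + 1" "int (2 * i - 1 + (2 * n - 1)) = 2 * r + 1 + 2 * int n - 1"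
      using r assms by (auto simp: i_def of_nat_diff)
    have "c = polygon_chord (4 * n + 2) (2 * i - 1) (2 * n - 1)"
      unfolding c polygon_chord_def pv i e e' ..
    moreover have "i \<in> {1..2 * n + 1}" using r by (auto simp: i_def)
    ultimately show "c \<in> ?A" by blast
  qed
  then show ?thesis by (simp add: odd_diagram_def)
qed

lemma odd_diagram_points:
  assumes "n \<ge> 1"
  shows "fst (odd_diagram n) = range (vertex n)"
proof -
  have "vertex n j \<in> \<Union>{{vertex n j, vertex n (j + 2 * int n - 1)} |j. odd j}" for j
  proof (cases "odd j")
    case False
    then have "odd (j - 2 * int n + 1)" by simp
    moreover have "vertex n j = vertex n ((j - 2 * int n + 1) + 2 * int n - 1)" by simp
    ultimately show ?thesis by blast
  qed auto
  then show ?thesis by (auto simp: odd_diagram_conv[OF assms] diagram_of_chords_def)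
qed

text \<open>Chords join an odd index to an even one, and shifting indices is injective on vertices;
  so no vertex lies on two chords, and \<open>THE\<close> has a unique candidate.\<close>

lemma odd_diagram_partner:
  assumes "n \<ge> 1" "odd j"
  shows "snd (odd_diagram n) (vertex n j) = vertex n (j + 2 * int n - 1)" (is ?A)
    and "snd (odd_diagram n) (vertex n (j + 2 * int n - 1)) = vertex n j" (is ?B)
proof -
  let ?K = "{{vertex n j, vertex n (j + 2 * int n - 1)} |j. odd j}"
  have par: "vertex n i \<noteq> vertex n (k + 2 * int n - 1)" if "odd i" "odd k" for i k
    using vertex_eq_parity[of n i "k + 2 * int n - 1"] that by auto
  have shift: "vertex n i = vertex n k \<longleftrightarrow> vertex n (i + 2 * int n - 1) = vertex n (k + 2 * int n - 1)" for i k
    unfolding vertex_eq_iff by simp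
  have "(THE y. {vertex n j, y} \<in> ?K) = vertex n (j + 2 * int n - 1)"
  proof (rule the_equality)
    fix y assume "{vertex n j, y} \<in> ?K"
    then obtain k where k: "odd k" "{vertex n j, y} = {vertex n k, vertex n (k + 2 * int n - 1)}" by blast
    then show "y = vertex n (j + 2 * int n - 1)"
      using par[OF assms(2) k(1)] shift[of j k] by (auto simp: doubleton_eq_iff)
  qed (use assms in blast)
  then show ?A by (simp add: odd_diagram_conv[OF assms(1)] diagram_of_chords_def)
  have "(THE y. {vertex n (j + 2 * int n - 1), y} \<in> ?K) = vertex n j"
  proof (rule the_equality)
    show "{vertex n (j + 2 * int n - 1), vertex n j} \<in> ?K"
      using assms(2) by (subst insert_commute) blast
    fix y assume "{vertex n (j + 2 * int n - 1), y} \<in> ?K"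
    then obtain k where k: "odd k"
      "{vertex n (j + 2 * int n - 1), y} = {vertex n k, vertex n (k + 2 * int n - 1)}" by blast
    then show "y = vertex n j"
      using par[OF k(1) assms(2)] shift[of j k] by (auto simp: doubleton_eq_iff)
  qed
  then show ?B by (simp add: odd_diagram_conv[OF assms(1)] diagram_of_chords_def)
qed

text \<open>Vertices outside \<open>X\<close> lie in \<open>Y\<close>, so connectedness of
  \<open>X\<close> puts a run of \<open>2 * n + 1\<close> consecutive vertices into one of the two
  sets.\<close>

lemma odd_diagram_not_two_arcs:
  assumes n: "n \<ge> 1" and X: "connected X" "X \<subseteq> S1" and XY: "X \<union> Y = S1"
  obtains z where "z \<in> fst (odd_diagram n)"
    "{z, snd (odd_diagram n) z} \<subseteq> X \<or> {z, snd (odd_diagram n) z} \<subseteq> Y"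
proof (cases "X = S1")
  case True
  have "vertex n i \<in> X" for i by (auto simp: vertex_def True)
  then show ?thesis
    using odd_diagram_partner[OF n, of 1] odd_diagram_points[OF n]
    by (intro that[of "vertex n 1"]) auto
next
  case False
  obtain x where x: "(\<forall>j\<in>{x..x + 2 * int n}. vertex n j \<in> X) \<or>
      (\<forall>j\<in>{x..x + 2 * int n}. vertex n j \<notin> X)"
    using half_of_vertices[OF X False] by blast
  have "vertex n j \<in> S1" for j by (simp add: vertex_def)
  with XY x have x': "(\<forall>j\<in>{x..x + 2 * int n}. vertex n j \<in> X) \<or>
      (\<forall>j\<in>{x..x + 2 * int n}. vertex n j \<in> Y)" by blast
  \<comment> \<open>The first odd index of the run: at most one place after its start, so the chord,
    which advances by \<open>2 * n - 1\<close>, still ends inside the run.\<close>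
  define j where "j = (if odd x then x else x + 1)"
  have j: "odd j" "j \<in> {x..x + 2 * int n}" "j + 2 * int n - 1 \<in> {x..x + 2 * int n}"
    using n by (auto simp: j_def)
  show ?thesis
    using x' j odd_diagram_partner(1)[OF n j(1)] odd_diagram_points[OF n]
    by (intro that[of "vertex n j"]) auto
qed

section \<open>Chains of consecutive chords\<close>

text \<open>Here \<open>P \<noteq> {}\<close> expresses that there is a chord, which rules out arc
  number 1.\<close>

locale chord_diagram =
  fixes P :: "complex set" and \<phi> :: "complex \<Rightarrow> complex"
  assumes points: "P \<subseteq> S1" "finite P" "P \<noteq> {}"
    and partner: "x \<in> P \<Longrightarrow> \<phi> x \<in> P" "x \<in> P \<Longrightarrow> \<phi> x \<noteq> x" "x \<in> P \<Longrightarrow> \<phi> (\<phi> x) = x"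
begin

section \<open>Arc number two in terms of chord-free arcs\<close>

definition chord_free :: "complex set \<Rightarrow> bool"
  where "chord_free X \<longleftrightarrow> (\<forall>x\<in>P. \<not> (x \<in> X \<and> \<phi> x \<in> X))"

text \<open>As \<open>\<phi>\<close> is an involution, the chord relation together with equality is
  already transitive, and classes have at most two points.\<close>

lemma chord_equiv_iff:
  "(x, y) \<in> chord_equiv (P, \<phi>) \<longleftrightarrow> x \<in> S1 \<and> y \<in> S1 \<and> (x = y \<or> x \<in> P \<and> y = \<phi> x)"
proof -
  let ?R = "\<lambda>u v. u \<in> P \<and> v = \<phi> u"
  have "x = y \<or> x \<in> P \<and> y = \<phi> x" if "equivclp ?R x y"
    using that
  proof (induction rule: equivclp_induct)
    case (step y z)
    then show ?case using partner by metis
  qed auto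
  moreover have "equivclp ?R x y" if "x = y \<or> x \<in> P \<and> y = \<phi> x"
    using that by auto
  ultimately show ?thesis by (auto simp: chord_equiv_def)
qed

lemma quotient_map_eq_iff:
  assumes "x \<in> S1" "y \<in> S1"
  shows "quotient_map_of (P, \<phi>) x = quotient_map_of (P, \<phi>) y \<longleftrightarrow> x = y \<or> x \<in> P \<and> y = \<phi> x"
proof -
  have "quotient_map_of (P, \<phi>) x = {z \<in> S1. x = z \<or> x \<in> P \<and> z = \<phi> x}" if "x \<in> S1" for x
    using that by (auto simp: quotient_map_of_def chord_equiv_iff)
  moreover have "\<phi> x \<in> S1" if "x \<in> P" for x using partner(1) points that by blast
  ultimately show ?thesis using assms partner by auto
qed

lemma inj_on_quotient_map_iff:
  assumes "X \<subseteq> S1"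
  shows "inj_on (quotient_map_of (P, \<phi>)) X \<longleftrightarrow> chord_free X"
proof
  assume inj: "inj_on (quotient_map_of (P, \<phi>)) X"
  show "chord_free X" unfolding chord_free_def
  proof (intro ballI notI)
    fix x assume "x \<in> P" "x \<in> X \<and> \<phi> x \<in> X"
    then have "x = \<phi> x"
      using assms by (intro inj_onD[OF inj]) (auto simp: quotient_map_eq_iff subset_iff)
    then show False using partner(2) \<open>x \<in> P\<close> by metis
  qed
next
  assume "chord_free X"
  then show "inj_on (quotient_map_of (P, \<phi>)) X"
    using assms by (intro inj_onI) (auto simp: quotient_map_eq_iff chord_free_def subset_iff)
qed

text \<open>An existing chord excludes the injective case. The infimum runs over numbers from 2 on,
  and a nonempty set of extended naturals attains its infimum, so the value is 2 exactly when 2 is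
  in the set.\<close>

lemma arc_number_eq_2_iff:
  "diagram_arc_number (P, \<phi>) = 2 \<longleftrightarrow>
    (\<exists>X Y. X homeomorphic {0..1::real} \<and> Y homeomorphic {0..1::real} \<and>
      chord_free X \<and> chord_free Y \<and> X \<union> Y = S1)"
proof -
  let ?f = "quotient_map_of (P, \<phi>)"
  let ?A = "{enat n |n. 1 < n \<and> divides_into_arc_embeddings ?f n}"
  have "\<not> chord_free S1"
    using points partner(1) unfolding chord_free_def by (meson all_not_in_conv subsetD)
  then have "diagram_arc_number (P, \<phi>) = Inf ?A"
    by (simp add: diagram_arc_number_def arc_number_def inj_on_quotient_map_iff)
  moreover have "Inf ?A = 2 \<longleftrightarrow> divides_into_arc_embeddings ?f 2"
  proof
    assume inf: "Inf ?A = 2"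
    have ne: "?A \<noteq> {}"
    proof
      assume "?A = {}"
      then have "Inf ?A = \<infinity>" by (simp only: Inf_enat_def simp_thms if_True)
      with inf show False by simp
    qed
    then obtain a where "a \<in> ?A" by blast
    then have "(LEAST a. a \<in> ?A) \<in> ?A" by (rule LeastI)
    then have "Inf ?A \<in> ?A" unfolding Inf_enat_def using ne by (simp only: if_False)
    then show "divides_into_arc_embeddings ?f 2"
      unfolding inf by (auto simp: numeral_eq_enat)
  next
    assume "divides_into_arc_embeddings ?f 2"
    then have "2 \<in> ?A" by (auto simp: numeral_eq_enat)
    then have "Inf ?A \<le> 2" by (rule Inf_lower)
    moreover have "2 \<le> Inf ?A" by (rule Inf_greatest) (auto simp: numeral_eq_enat)
    ultimately show "Inf ?A = 2" by (rule antisym)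
  qed
  moreover have "divides_into_arc_embeddings ?f 2 \<longleftrightarrow>
    (\<exists>X Y. X homeomorphic {0..1::real} \<and> Y homeomorphic {0..1::real} \<and>
      chord_free X \<and> chord_free Y \<and> X \<union> Y = S1)" (is "?L \<longleftrightarrow> ?R")
  proof
    have two: "{1..2::nat} = {1, 2}" by auto
    show ?R if ?L
    proof -
      from that obtain I :: "nat \<Rightarrow> complex set"
        where I: "\<forall>i\<in>{1, 2}. I i \<subseteq> S1 \<and> I i homeomorphic {0..1::real} \<and> inj_on ?f (I i)"
          "S1 = (\<Union>i\<in>{1, 2}. I i)"
        unfolding divides_into_arc_embeddings_def two by blast
      then show ?R
        by (intro exI[of _ "I 1"] exI[of _ "I 2"]) (simp add: inj_on_quotient_map_iff)
    qed
    show ?L if ?R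
    proof -
      from that obtain X Y where XY: "X homeomorphic {0..1::real}" "Y homeomorphic {0..1::real}"
        "chord_free X" "chord_free Y" "X \<union> Y = S1" by blast
      moreover have "X \<subseteq> S1" "Y \<subseteq> S1" using XY(5) by auto
      ultimately show ?L
        unfolding divides_into_arc_embeddings_def two
        by (intro exI[of _ "\<lambda>i. if i = 1 then X else Y"]) (auto simp: inj_on_quotient_map_iff)
    qed
  qed
  ultimately show ?thesis by simp
qed

text \<open>The homeomorphism \<open>h\<close> of the equivalence carries the two chord-free arcs to
  two sets covering the circle. One of them contains both ends of a chord of
  \<open>odd_diagram n\<close>, and injectivity of \<open>h\<close> pulls this chord back.\<close>

lemma no_odd_subdiagram:
  assumes arc: "diagram_arc_number (P, \<phi>) = 2" and n: "n \<ge> 1"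
    and sub: "sub_diagram D (P, \<phi>)" and eq: "equivalent_diagrams D (odd_diagram n)"
  shows False
proof -
  obtain Q \<psi> where D: "D = (Q, \<psi>)" by (cases D)
  obtain m where m: "is_chord_diagram m (Q, \<psi>)" and Q: "Q \<subseteq> P" "\<And>x. x \<in> Q \<Longrightarrow> \<psi> x = \<phi> x"
    using sub unfolding D sub_diagram_def by auto
  obtain h where h: "orientation_preserving_homeo h" and hQ: "h ` Q = fst (odd_diagram n)"
    and h\<psi>: "\<And>x. x \<in> Q \<Longrightarrow> h (\<psi> x) = snd (odd_diagram n) (h x)"
    using eq unfolding D equivalent_diagrams_def by (auto split: prod.splits)
  obtain X Y where XY: "X homeomorphic {0..1::real}" "chord_free X" "chord_free Y" "X \<union> Y = S1"
    using arc unfolding arc_number_eq_2_iff by blast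
  obtain k where k: "homeomorphism S1 S1 h k"
    using h unfolding orientation_preserving_homeo_def by blast
  then have conth: "continuous_on S1 h" and imh: "h ` S1 = S1" and kh: "\<And>x. x \<in> S1 \<Longrightarrow> k (h x) = x"
    by (auto simp: homeomorphism_def)
  have conX: "connected X"
    using XY(1) homeomorphic_connectedness[of X "{0..1::real}"] by simp
  have con: "connected (h ` X)"
    using conX XY(4) by (intro connected_continuous_image continuous_on_subset[OF conth]) auto
  have "h ` X \<union> h ` Y = S1" using XY(4) imh by (simp flip: image_Un)
  moreover have "h ` X \<subseteq> S1" using XY(4) imh by blast
  ultimately obtain z where z: "z \<in> fst (odd_diagram n)"
    "{z, snd (odd_diagram n) z} \<subseteq> h ` X \<or> {z, snd (odd_diagram n) z} \<subseteq> h ` Y"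
    using odd_diagram_not_two_arcs[OF n con, of "h ` Y" thesis] by blast
  then obtain x where x: "x \<in> Q" "z = h x" using hQ by auto
  have S1: "x \<in> S1" "\<phi> x \<in> S1" "x \<in> P" using x Q points(1) partner(1) by blast+
  have "\<phi> x \<in> Z" "x \<in> Z" if "{h x, h (\<phi> x)} \<subseteq> h ` Z" "Z \<subseteq> S1" for Z
  proof -
    have "y \<in> Z" if "y \<in> S1" "h y \<in> h ` Z" for y
      using that \<open>Z \<subseteq> S1\<close> kh by (metis imageE subsetD)
    then show "\<phi> x \<in> Z" "x \<in> Z" using that S1 by auto
  qed
  moreover have "X \<subseteq> S1" "Y \<subseteq> S1" using XY(4) by auto
  moreover have "{h x, h (\<phi> x)} \<subseteq> h ` X \<or> {h x, h (\<phi> x)} \<subseteq> h ` Y"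
    using z(2) h\<psi>[OF x(1)] Q(2)[OF x(1)] x by simp
  ultimately have "x \<in> X \<and> \<phi> x \<in> X \<or> x \<in> Y \<and> \<phi> x \<in> Y" by meson
  then show False using XY(2,3) S1(3) unfolding chord_free_def by blast
qed

section \<open>Lifting chord ends to the real line\<close>

definition lifts :: "real set"
  where "lifts = {t. cis t \<in> P}"

text \<open>The first lift after \<open>t\<close> of the other end of the chord at \<open>cis t\<close>.\<close>

definition next_end :: "real \<Rightarrow> real"
  where "next_end t = t + Arg2pi (\<phi> (cis t) / cis t)"

lemma lifts_shift_iff [simp]: "t + 2 * pi * of_int k \<in> lifts \<longleftrightarrow> t \<in> lifts"
  by (simp add: lifts_def)

lemma next_end_shift [simp]: "next_end (t + 2 * pi * of_int k) = next_end t + 2 * pi * of_int k"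
  by (simp add: next_end_def)

lemma cis_next_end:
  assumes "t \<in> lifts"
  shows "cis (next_end t) = \<phi> (cis t)"
proof -
  have "\<phi> (cis t) \<in> P" using assms partner(1) by (simp add: lifts_def)
  then have "\<phi> (cis t) \<in> S1" using points(1) by blast
  then have "cis (Arg2pi (\<phi> (cis t) / cis t)) = \<phi> (cis t) / cis t"
    by (intro cis_Arg2pi) (simp add: norm_divide)
  then show ?thesis by (simp add: next_end_def flip: cis_mult)
qed

lemma next_end_in_lifts: "t \<in> lifts \<Longrightarrow> next_end t \<in> lifts"
  using partner(1) by (simp add: cis_next_end lifts_def)

lemma next_end_bounds:
  assumes "t \<in> lifts"
  shows "t < next_end t" "next_end t < t + 2 * pi"
proof -
  have "next_end t \<noteq> t"
    using cis_next_end[OF assms] partner(2)[of "cis t"] assms by (auto simp: lifts_def)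
  then show "t < next_end t" "next_end t < t + 2 * pi"
    using Arg2pi[of "\<phi> (cis t) / cis t"] by (auto simp: next_end_def)
qed

lemma next_end_le:
  assumes "t \<in> lifts" "t < t'" "cis t' = \<phi> (cis t)"
  shows "next_end t \<le> t'"
proof (rule ccontr)
  assume less: "\<not> ?thesis"
  have "t' = next_end t"
    by (rule cis_eq_imp_eq) (use assms less next_end_bounds[OF assms(1)] in \<open>auto simp: cis_next_end\<close>)
  with less show False by simp
qed

text \<open>The ends of a chord cut the circle into two arcs, and the two jumps traverse one arc
  each.\<close>

lemma next_end_next_end:
  assumes "t \<in> lifts"
  shows "next_end (next_end t) = t + 2 * pi"
proof (rule cis_eq_imp_eq)
  note n = next_end_in_lifts[OF assms]
  have "cis (next_end (next_end t)) = \<phi> (\<phi> (cis t))" by (simp add: cis_next_end n assms)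
  also have "\<dots> = cis t" using assms by (simp add: partner(3) lifts_def)
  finally show "cis (next_end (next_end t)) = cis (t + 2 * pi)"
    using cis_add_int[of t 1] by simp
  show "\<bar>next_end (next_end t) - (t + 2 * pi)\<bar> < 2 * pi"
    using next_end_bounds[OF assms] next_end_bounds[OF n] by linarith
qed

section \<open>Covering the circle by two arcs\<close>

lemma finite_lifts_interval: "finite (lifts \<inter> {a..<a + 2 * pi})"
proof (rule finite_imageD)
  show "finite (cis ` (lifts \<inter> {a..<a + 2 * pi}))"
    by (rule finite_subset[OF _ points(2)]) (auto simp: lifts_def)
  show "inj_on cis (lifts \<inter> {a..<a + 2 * pi})"
    by (rule inj_onI, rule cis_eq_imp_eq) auto
qed

text \<open>The lifts are discrete. This allows cutting just before a chord end, which keeps the cut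
  points, shared by both closed arcs, out of \<open>P\<close>.\<close>

lemma gap_below:
  assumes "b < t"
  obtains t' where "b < t'" "t' < t" "{t'..<t} \<inter> lifts = {}"
proof -
  \<comment> \<open>With \<open>t - 2 * pi\<close> included, a lift between \<open>t'\<close> and
    \<open>t\<close> would belong to \<open>A\<close> and hence lie below \<open>t'\<close>.\<close>
  define A where "A = insert b (insert (t - 2 * pi) (lifts \<inter> {t - 2 * pi..<t}))"
  have fin: "finite A" using finite_lifts_interval[of "t - 2 * pi"] by (simp add: A_def)
  have "Max A \<in> A" using fin by (intro Max_in) (auto simp: A_def)
  then have "Max A < t" using assms pi_gt_zero by (auto simp: A_def)
  then obtain t' where t': "Max A < t'" "t' < t" using dense by blast
  have A: "a < t'" if "a \<in> A" for a using Max_ge[OF fin that] t'(1) by linarith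
  show thesis
  proof
    show "b < t'" using A by (simp add: A_def)
    show "{t'..<t} \<inter> lifts = {}"
    proof (intro equals0I)
      fix s assume s: "s \<in> {t'..<t} \<inter> lifts"
      have "t - 2 * pi < t'" using A by (simp add: A_def)
      with s have "s \<in> A" by (simp add: A_def)
      with A[of s] s show False by auto
    qed
  qed (use t' in simp)
qed

text \<open>If both ends of a chord have lifts in the interval, the later lift is at least
  \<open>next_end\<close> of the earlier.\<close>

lemma chord_free_arc:
  assumes "\<And>t. \<lbrakk>t \<in> lifts; a \<le> t\<rbrakk> \<Longrightarrow> b < next_end t"
  shows "chord_free (cis ` {a..b})"
  unfolding chord_free_def
proof (intro ballI notI)
  fix x assume x: "x \<in> P" "x \<in> cis ` {a..b} \<and> \<phi> x \<in> cis ` {a..b}"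
  then obtain s t where st: "x = cis s" "\<phi> x = cis t" "s \<in> {a..b}" "t \<in> {a..b}" by blast
  then have "s \<in> lifts" "t \<in> lifts" using x(1) partner(1)[OF x(1)] by (auto simp: lifts_def)
  moreover have "s \<noteq> t" using st partner(2)[OF x(1)] by auto
  moreover have "cis s = \<phi> (cis t)" "cis t = \<phi> (cis s)"
    using st(1,2) partner(3)[OF x(1)] by simp_all
  ultimately have "next_end s \<le> t \<or> next_end t \<le> s"
    using next_end_le by (metis linorder_neqE_linordered_idom)
  moreover have "b < next_end s" "b < next_end t"
    using assms st(3,4) \<open>s \<in> lifts\<close> \<open>t \<in> lifts\<close> by auto
  ultimately show False using st(3,4) by auto
qed

lemma homeomorphic_arc:
  assumes "a < b" "b < a + 2 * pi"
  shows "cis ` {a..b} homeomorphic {0..1::real}"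
proof -
  have "{a..b} homeomorphic cis ` {a..b}"
  proof (rule homeomorphic_compact)
    show "continuous_on {a..b} cis" unfolding cis_conv_exp by (intro continuous_intros)
    show "inj_on cis {a..b}"
      by (rule inj_onI, rule cis_eq_imp_eq) (use assms in auto)
  qed auto
  then show ?thesis
    using homeomorphic_closed_intervals_real[OF assms(1), of 0 1]
    by (meson homeomorphic_sym homeomorphic_trans zero_less_one)
qed

text \<open>The greedy choice: the first arc runs from just before \<open>x\<close> to just before the first point
  that would complete a chord, and the hypothesis lets the second arc return to its start.\<close>

lemma two_arcs:
  assumes x: "\<not> (\<exists>a\<in>lifts. \<exists>b\<in>lifts. x \<le> a \<and> next_end a \<le> b \<and> next_end b < x + 2 * pi)"
  shows "diagram_arc_number (P, \<phi>) = 2"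
proof -
  obtain x' where x': "x' < x" "{x'..<x} \<inter> lifts = {}"
    using gap_below[of "x - 1" x] by auto
  have above: "x \<le> t" if "t \<in> lifts" "x' \<le> t" for t
  proof (rule ccontr)
    assume "\<not> x \<le> t"
    then have "t \<in> {x'..<x} \<inter> lifts" using that by auto
    then show False using x'(2) by blast
  qed
  \<comment> \<open>The strict bound at \<open>x\<close> in the assumption leaves room for the
    nonstrict one at \<open>x'\<close>.\<close>
  have no: False if "a \<in> lifts" "b \<in> lifts" "x' \<le> a" "next_end a \<le> b" "next_end b \<le> x' + 2 * pi" for a b
  proof -
    have "next_end b < x + 2 * pi" using that(5) x'(1) by linarith
    then show False using x above[OF that(1,3)] that(1,2,4) by blast
  qed
  define A where "A = lifts \<inter> {x'..<x' + 2 * pi}"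
  have finA: "finite A" unfolding A_def by (rule finite_lifts_interval)
  have rep: "\<exists>t\<in>A. cis t = z" if "z \<in> P" for z
  proof -
    have "z \<in> S1" using that points by blast
    then have "z / cis x' \<in> S1" by (simp add: norm_divide)
    then have "cis (x' + Arg2pi (z / cis x')) = z"
      by (simp add: cis_Arg2pi flip: cis_mult)
    then show ?thesis
      using that Arg2pi[of "z / cis x'"]
      by (intro bexI[of _ "x' + Arg2pi (z / cis x')"]) (auto simp: A_def lifts_def)
  qed
  have neA: "A \<noteq> {}" using rep points(3) by blast
  define B where "B = Min (next_end ` A)"
  have "B \<in> next_end ` A" unfolding B_def using finA neA by (intro Min_in) auto
  then obtain a where a: "a \<in> A" "B = next_end a" by blast
  have B_le: "B \<le> next_end t" if "t \<in> A" for t unfolding B_def using finA that by simp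
  have a': "a \<in> lifts" "x' \<le> a" using a(1) by (auto simp: A_def)
  have "x' < B" using a(2) a' next_end_bounds[OF a'(1)] by linarith
  \<comment> \<open>Both ends of the chord at \<open>cis a\<close> have lifts in this turn, and
    \<open>B\<close> is at most the later of the two.\<close>
  have B_less: "B < x' + 2 * pi"
  proof -
    have "\<phi> (cis a) \<in> P" using a'(1) partner(1) by (simp add: lifts_def)
    then obtain c where c: "c \<in> A" "cis c = \<phi> (cis a)" using rep by blast
    then have c': "c \<in> lifts" "c < x' + 2 * pi" by (auto simp: A_def)
    have "c \<noteq> a" using c(2) a'(1) partner(2)[of "cis a"] by (auto simp: lifts_def)
    moreover have "cis a = \<phi> (cis c)" using c(2) a'(1) partner(3) by (simp add: lifts_def)
    ultimately have "next_end a \<le> c \<or> next_end c \<le> a"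
      using next_end_le c(2) a'(1) c'(1) by (metis linorder_neqE_linordered_idom)
    moreover have "a < x' + 2 * pi" using a(1) by (simp add: A_def)
    ultimately show ?thesis using c' B_le[OF c(1)] B_le[OF a(1)] by linarith
  qed
  obtain y where y: "x' < y" "y < B" "{y..<B} \<inter> lifts = {}"
    using gap_below[OF \<open>x' < B\<close>] by blast
  have ends: "B \<le> next_end t" if "t \<in> lifts" "x' \<le> t" for t
  proof (cases "t < x' + 2 * pi")
    case True
    then show ?thesis using B_le that by (simp add: A_def)
  next
    case False
    then show ?thesis using B_less next_end_bounds[OF that(1)] by linarith
  qed
  have "chord_free (cis ` {x'..y})"
  proof (rule chord_free_arc)
    fix t assume "t \<in> lifts" "x' \<le> t"
    then show "y < next_end t" using ends[of t] y(2) by linarith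
  qed
  \<comment> \<open>A chord inside this arc starts no earlier than \<open>B = next_end a\<close>;
    following the chord at \<open>a\<close>, it would contradict \<open>no\<close>.\<close>
  moreover have "chord_free (cis ` {y..x' + 2 * pi})"
  proof (rule chord_free_arc)
    fix t assume t: "t \<in> lifts" "y \<le> t"
    have "B \<le> t"
    proof (rule ccontr)
      assume "\<not> B \<le> t"
      then have "t \<in> {y..<B} \<inter> lifts" using t by auto
      then show False using y(3) by blast
    qed
    then show "x' + 2 * pi < next_end t"
      using no[OF a'(1) t(1) a'(2)] a(2) by force
  qed
  moreover have "cis ` {x'..y} homeomorphic {0..1::real}"
    using y(1,2) B_less by (intro homeomorphic_arc) auto
  moreover have "cis ` {y..x' + 2 * pi} homeomorphic {0..1::real}"
    using y(1,2) B_less by (intro homeomorphic_arc) auto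
  moreover have "cis ` {x'..y} \<union> cis ` {y..x' + 2 * pi} = S1"
  proof (intro equalityI subsetI)
    fix z assume "z \<in> S1"
    then have "z / cis x' \<in> S1" by (simp add: norm_divide)
    then have z: "cis (x' + Arg2pi (z / cis x')) = z"
      by (simp add: cis_Arg2pi flip: cis_mult)
    have "x' + Arg2pi (z / cis x') \<in> {x'..y} \<union> {y..x' + 2 * pi}"
      using y(1,2) B_less Arg2pi[of "z / cis x'"] by auto
    then show "z \<in> cis ` {x'..y} \<union> cis ` {y..x' + 2 * pi}"
      using z by (metis image_Un imageI)
  qed auto
  ultimately show ?thesis unfolding arc_number_eq_2_iff by blast
qed

section \<open>Chains of an odd number of chords\<close>

definition closed_chain :: "nat \<Rightarrow> (nat \<Rightarrow> real) \<Rightarrow> bool"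
  where "closed_chain n c \<longleftrightarrow> (\<forall>j\<le>2 * n. c j \<in> lifts) \<and>
    (\<forall>j<2 * n. next_end (c j) \<le> c (Suc j)) \<and> next_end (c (2 * n)) \<le> c 0 + 2 * pi * real n"

lemma not_closed_chain_0: "\<not> closed_chain 0 c"
  using next_end_bounds(1)[of "c 0"] by (auto simp: closed_chain_def)

text \<open>Iterating the two-chord step, positions \<open>j < k\<close> lie over the same point of
  \<open>P\<close>. The \<open>r = k - j\<close> steps between them use \<open>2 * r\<close> chords
  but, each being shorter than a turn, advance by at most \<open>r - 1\<close> turns. Omitting the
  last chord leaves \<open>2 * (r - 1) + 1\<close>.\<close>

lemma ex_closed_chain:
  assumes arc: "diagram_arc_number (P, \<phi>) \<noteq> 2"
  shows "\<exists>n c. closed_chain n c"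
proof -
  have "\<exists>a b. a \<in> lifts \<and> b \<in> lifts \<and> x \<le> a \<and> next_end a \<le> b \<and> next_end b < x + 2 * pi" for x
    using two_arcs[of x] arc by blast
  then obtain \<alpha> \<beta> where \<alpha>: "\<And>x. \<alpha> x \<in> lifts" and \<beta>: "\<And>x. \<beta> x \<in> lifts"
    and \<alpha>\<beta>: "\<And>x. x \<le> \<alpha> x" "\<And>x. next_end (\<alpha> x) \<le> \<beta> x" "\<And>x. next_end (\<beta> x) < x + 2 * pi"
    by metis
  \<comment> \<open>Starting at a chord end makes every \<open>x k\<close> a lift, so that its image
    lies in the finite set \<open>P\<close>.\<close>
  define x where "x k = ((\<lambda>t. next_end (\<beta> t)) ^^ k) (next_end (\<beta> 0))" for k
  have xS: "x (Suc k) = next_end (\<beta> (x k))" for k by (simp add: x_def)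
  have x_lifts: "x k \<in> lifts" for k
    by (cases k) (simp_all add: x_def \<beta> next_end_in_lifts)
  have "\<not> inj (\<lambda>k. cis (x k))"
  proof
    assume "inj (\<lambda>k. cis (x k))"
    moreover have "finite (range (\<lambda>k. cis (x k)))"
      by (rule finite_subset[OF _ points(2)]) (use x_lifts in \<open>auto simp: lifts_def\<close>)
    ultimately show False using finite_imageD by blast
  qed
  then obtain j k where jk: "j < k" "cis (x k) = cis (x j)"
    unfolding inj_def by (metis linorder_neqE_nat)
  then obtain L where L: "x k = x j + 2 * pi * of_int L" using cis_eq_cis_iff by blast
  define r where "r = k - j"
  have r: "r > 0" "k = j + r" using jk(1) by (auto simp: r_def)
  \<comment> \<open>Strictness matters: the total advance is a whole number \<open>L\<close> of
    turns, so \<open>L < r\<close> sharpens to \<open>L \<le> r - 1\<close>.\<close>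
  have "x (j + i) < x j + 2 * pi * real i \<or> i = 0" for i
  proof (induction i)
    case (Suc i)
    then show ?case using \<alpha>\<beta>(3)[of "x (j + i)"] by (auto simp: xS algebra_simps)
  qed simp
  from this[of r] have "2 * pi * real_of_int L < 2 * pi * real r" using L r by simp
  then have "real_of_int L < real r" by (subst (asm) mult_less_cancel_left_pos) auto
  then have "L \<le> int r - 1" by linarith
  then have "real_of_int L \<le> real (r - 1)" using r(1) by (simp add: of_nat_diff)
  then have xk: "x k \<le> x j + 2 * pi * real (r - 1)" unfolding L by simp
  define c where "c i = (if even i then \<alpha> (x (j + i div 2)) else \<beta> (x (j + i div 2)))" for i
  have c_step: "next_end (c i) \<le> c (Suc i)" for i
  proof (cases "even i")
    case True
    then show ?thesis using \<alpha>\<beta>(2) by (simp add: c_def)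
  next
    case False
    then have "Suc i div 2 = Suc (i div 2)" by presburger
    then show ?thesis using False \<alpha>\<beta>(1)[of "x (Suc (j + i div 2))"] by (simp add: c_def xS)
  qed
  have "closed_chain (r - 1) c"
    unfolding closed_chain_def
  proof (intro conjI allI impI)
    show "c i \<in> lifts" for i using \<alpha> \<beta> by (simp add: c_def)
    show "next_end (c i) \<le> c (Suc i)" for i by (rule c_step)
    \<comment> \<open>The chain ends with an \<open>\<alpha>\<close>; the chord at
      \<open>\<beta>\<close> of the last step is the omitted one.\<close>
    have "c (2 * (r - 1)) = \<alpha> (x (j + (r - 1)))" by (simp add: c_def)
    then have "next_end (c (2 * (r - 1))) \<le> \<beta> (x (j + (r - 1)))" using \<alpha>\<beta>(2) by simp
    also have "\<dots> \<le> next_end (\<beta> (x (j + (r - 1))))"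
      using next_end_bounds(1)[OF \<beta>] by (rule less_imp_le)
    also have "\<dots> = x k" using r by (simp flip: xS)
    also note xk
    also have "x j \<le> c 0" using \<alpha>\<beta>(1) by (simp add: c_def)
    finally show "next_end (c (2 * (r - 1))) \<le> c 0 + 2 * pi * real (r - 1)" by simp
  qed
  then show ?thesis by blast
qed

definition periodic_chain :: "nat \<Rightarrow> (int \<Rightarrow> real) \<Rightarrow> bool"
  where "periodic_chain n a \<longleftrightarrow> (\<forall>i. a i \<in> lifts) \<and> (\<forall>i. next_end (a i) \<le> a (i + 1)) \<and>
    (\<forall>i. a (i + (2 * int n + 1)) = a i + 2 * pi * real n)"

text \<open>Copies of the chain are strung together, each \<open>n\<close> turns after the previous
  one. The closing condition of the chain handles the seams.\<close>

lemma periodic_chain_of_closed_chain: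
  assumes "closed_chain n c"
  shows "\<exists>a. periodic_chain n a"
proof -
  define N where "N = 2 * int n + 1"
  have N: "N > 0" by (simp add: N_def)
  define a where "a i = c (nat (i mod N)) + 2 * pi * real n * of_int (i div N)" for i
  have a_alt: "a i = c (nat (i mod N)) + 2 * pi * of_int (int n * (i div N))" for i
    by (simp add: a_def)
  have c: "\<And>j. j \<le> 2 * n \<Longrightarrow> c j \<in> lifts" "\<And>j. j < 2 * n \<Longrightarrow> next_end (c j) \<le> c (Suc j)"
    "next_end (c (2 * n)) \<le> c 0 + 2 * pi * real n"
    using assms by (auto simp: closed_chain_def)
  have range: "nat (i mod N) \<le> 2 * n" for i
    using pos_mod_bound[OF N, of i] by (simp add: N_def)
  have per: "a (i + N) = a i + 2 * pi * real n" for i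
    using N by (simp add: a_def algebra_simps)
  have "next_end (a i) \<le> a (i + 1)" for i
  proof (cases "i mod N = N - 1")
    case True
    moreover have "N * (i div N) + i mod N = i" by simp
    ultimately have i: "i + 1 = N * (i div N + 1)" by (simp only: distrib_left)
    have "nat (i mod N) = 2 * n" unfolding True by (simp add: N_def)
    then have "next_end (a i) = next_end (c (2 * n)) + 2 * pi * of_int (int n * (i div N))"
      unfolding a_alt by (simp only: next_end_shift)
    also have "\<dots> \<le> c 0 + 2 * pi * real n + 2 * pi * of_int (int n * (i div N))" using c(3) by simp
    also have "\<dots> = a (i + 1)" unfolding a_def i using N by (simp add: algebra_simps)
    finally show ?thesis .
  next
    case False
    have m: "0 \<le> i mod N" "i mod N < N" using N by simp_all
    have i: "i + 1 = N * (i div N) + (i mod N + 1)" by simp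
    have "i mod N + 1 < N" using m False by linarith
    then have d: "(i + 1) div N = i div N" "(i + 1) mod N = i mod N + 1"
      using m(1) int_div_pos_eq[OF i] int_mod_pos_eq[OF i] by simp_all
    have n: "nat (i mod N + 1) = Suc (nat (i mod N))" using m by linarith
    have "next_end (a i) = next_end (c (nat (i mod N))) + 2 * pi * of_int (int n * (i div N))"
      unfolding a_alt by (simp only: next_end_shift)
    moreover have "nat (i mod N) < 2 * n" using m False unfolding N_def by linarith
    ultimately show ?thesis using c(2)[of "nat (i mod N)"] by (simp add: a_def d n)
  qed
  moreover have "a i \<in> lifts" for i
    unfolding a_alt lifts_shift_iff by (rule c(1)[OF range])
  ultimately have "periodic_chain n a" using per by (simp add: periodic_chain_def N_def)
  then show ?thesis by blast
qed

text \<open>The chords \<open>i + 1\<close> and \<open>i + 2\<close> are dropped, and the rest is closed up one turn earlier.\<close>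

lemma shorten_chain:
  assumes a: "periodic_chain n a" and n: "n \<ge> 1" and i: "next_end (a i) + 2 * pi \<le> a (i + 3)"
  shows "\<exists>c. closed_chain (n - 1) c"
proof -
  have "closed_chain (n - 1) (\<lambda>j. a (i + 3 + int j))"
    unfolding closed_chain_def
  proof (intro conjI allI impI)
    show "a (i + 3 + int j) \<in> lifts" for j using a by (simp add: periodic_chain_def)
    show "next_end (a (i + 3 + int j)) \<le> a (i + 3 + int (Suc j))" for j
      using a[unfolded periodic_chain_def, THEN conjunct2, THEN conjunct1, rule_format, of "i + 3 + int j"]
      by (simp add: algebra_simps)
    \<comment> \<open>The remaining \<open>2 * n - 1\<close> chords run from chord
      \<open>i + 3\<close> to chord \<open>i\<close> one period later.\<close>
    have "i + 3 + int (2 * (n - 1)) = i + (2 * int n + 1)" using n by (simp add: of_nat_diff)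
    moreover have "a (i + (2 * int n + 1)) = a i + 2 * pi * of_int (int n)"
      using a unfolding periodic_chain_def by (metis of_int_of_nat_eq)
    ultimately have "a (i + 3 + int (2 * (n - 1))) = a i + 2 * pi * of_int (int n)"
      by (simp only:)
    then have "next_end (a (i + 3 + int (2 * (n - 1)))) = next_end (a i) + 2 * pi * of_int (int n)"
      by (simp only: next_end_shift)
    also have "\<dots> \<le> a (i + 3 + int 0) + 2 * pi * real (n - 1)"
      using i n by (simp add: of_nat_diff algebra_simps)
    finally show "next_end (a (i + 3 + int (2 * (n - 1)))) \<le> a (i + 3 + int 0) + 2 * pi * real (n - 1)" .
  qed
  then show ?thesis by blast
qed

text \<open>For the least \<open>n\<close>, \<open>shorten_chain\<close> yields the second
  inequality. The first could fail only by equality, which contradicts the second.\<close>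

lemma ex_tight_chain:
  assumes "diagram_arc_number (P, \<phi>) \<noteq> 2"
  shows "\<exists>n\<ge>1. \<exists>a. periodic_chain n a \<and>
    (\<forall>i. next_end (a i) < a (i + 1) \<and> a (i + 3) < next_end (a i) + 2 * pi)"
proof -
  define n where "n = (LEAST n. \<exists>c. closed_chain n c)"
  have ex: "\<exists>c. closed_chain n c"
    unfolding n_def using ex_closed_chain[OF assms] by (rule LeastI_ex)
  have min: "\<not> closed_chain k c" if "k < n" for k c
    using not_less_Least[of k "\<lambda>n. \<exists>c. closed_chain n c"] that by (auto simp: n_def)
  have n: "n \<ge> 1" using ex not_closed_chain_0 by (cases n) auto
  obtain a where a: "periodic_chain n a" using ex periodic_chain_of_closed_chain by blast
  have hi: "a (i + 3) < next_end (a i) + 2 * pi" for i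
    using shorten_chain[OF a n, of i] min[of "n - 1"] n by force
  have a': "a i \<in> lifts" "next_end (a i) \<le> a (i + 1)" for i
    using a by (auto simp: periodic_chain_def)
  \<comment> \<open>Under equality, chord \<open>i + 1\<close> is chord \<open>i\<close> taken from
    its other end. The two complete a turn, so \<open>a (i + 2)\<close> is at least a turn beyond
    \<open>a i\<close>, hence beyond \<open>next_end (a (i - 1))\<close>.\<close>
  have "next_end (a i) \<noteq> a (i + 1)" for i
  proof
    assume "next_end (a i) = a (i + 1)"
    then have "next_end (a (i + 1)) = a i + 2 * pi"
      using next_end_next_end[OF a'(1)] by metis
    then have "a i + 2 * pi \<le> a (i + 2)" using a'(2)[of "i + 1"] by (simp add: algebra_simps)
    then show False using a'(2)[of "i - 1"] hi[of "i - 1"] by (simp add: algebra_simps)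
  qed
  then have "next_end (a i) < a (i + 1)" for i using a'(2)[of i] by (simp add: less_le)
  with n a hi show ?thesis by blast
qed

text \<open>In cyclic order the chord ends form an increasing sequence gaining one turn every
  \<open>4 * n + 2\<close> terms, as do the angles of the polygon vertices. Interpolation matches
  the two sequences, and chords join the same pairs of indices in both.\<close>

lemma odd_subdiagram_of_chain:
  assumes n: "n \<ge> 1" and chain: "periodic_chain n a"
    and lo: "\<And>i. next_end (a i) < a (i + 1)" and hi: "\<And>i. a (i + 3) < next_end (a i) + 2 * pi"
  shows "\<exists>D. sub_diagram D (P, \<phi>) \<and> equivalent_diagrams D (odd_diagram n)"
proof -
  have a_lifts: "a i \<in> lifts" and a_per: "a (i + (2 * int n + 1)) = a i + 2 * pi * of_int (int n)" for i
    using chain by (auto simp: periodic_chain_def)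
  define M where "M = 4 * int n + 2"
  have M: "real_of_int M > 0" by (simp add: M_def)
  \<comment> \<open>The end points of the chain in cyclic order: going round, the start of chord \<open>i\<close> is followed
    by the end of chord \<open>i - 3\<close> (by \<open>hi\<close>), and that by the start of chord \<open>i - 2\<close> (by \<open>lo\<close>).\<close>
  define u where "u j = (if odd j then a (1 - j) + 2 * pi * of_int ((j - 1) div 2)
    else next_end (a (- 1 - j)) + 2 * pi * of_int (j div 2))" for j
  have u_odd: "u (2 * k + 1) = a (- 2 * k) + 2 * pi * of_int k"
    and u_even: "u (2 * k) = next_end (a (- 1 - 2 * k)) + 2 * pi * of_int k" for k
    by (simp_all add: u_def)
  have u_mono: "u j < u (j + 1)" for j
  proof (cases "even j")
    case True
    then obtain k where j: "j = 2 * k" by blast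
    show ?thesis using lo[of "- 1 - 2 * k"] unfolding j u_odd u_even by simp
  next
    case False
    then obtain k where j: "j = 2 * k + 1" by (rule oddE)
    have "- 1 - 2 * (k + 1) + 3 = - 2 * k" by simp
    then have "a (- 2 * k) < next_end (a (- 1 - 2 * (k + 1))) + 2 * pi"
      using hi[of "- 1 - 2 * (k + 1)"] by simp
    moreover have "j + 1 = 2 * (k + 1)" by (simp add: j)
    ultimately show ?thesis
      unfolding \<open>j + 1 = 2 * (k + 1)\<close> u_even unfolding j u_odd by (simp add: algebra_simps)
  qed
  have a_per': "a (i - 2 * (2 * int n + 1)) = a i - 2 * (2 * pi * of_int (int n))" for i
    using a_per[of "i - (2 * int n + 1)"] a_per[of "i - 2 * (2 * int n + 1)"]
    by (simp add: algebra_simps)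
  \<comment> \<open>Adding \<open>M\<close> moves the chord index back by two periods, losing
    \<open>2 * n\<close> turns, while the explicit multiple of \<open>2 * pi\<close> gains
    \<open>2 * n + 1\<close>.\<close>
  have u_per: "u (j + M) = u j + 2 * pi" for j
  proof (cases "even j")
    case True
    then obtain k where j: "j = 2 * k" by blast
    have "next_end (a (- 1 - 2 * k - 2 * (2 * int n + 1)) + 2 * pi * of_int (2 * int n))
        = next_end (a (- 1 - 2 * k))"
      unfolding a_per' by simp
    then have "next_end (a (- 1 - 2 * k - 2 * (2 * int n + 1))) + 2 * pi * of_int (2 * int n)
        = next_end (a (- 1 - 2 * k))"
      unfolding next_end_shift .
    moreover have "j + M = 2 * (k + (2 * int n + 1))" by (simp add: j M_def)
    moreover have "- 1 - 2 * (k + (2 * int n + 1)) = - 1 - 2 * k - 2 * (2 * int n + 1)" by simp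
    ultimately show ?thesis
      by (simp only: u_even) (simp only: j u_even, simp add: algebra_simps)
  next
    case False
    then obtain k where j: "j = 2 * k + 1" by (rule oddE)
    have "j + M = 2 * (k + (2 * int n + 1)) + 1" by (simp add: j M_def)
    moreover have "- 2 * (k + (2 * int n + 1)) = - 2 * k - 2 * (2 * int n + 1)" by simp
    ultimately show ?thesis
      using a_per'[of "- 2 * k"]
      by (simp only: u_odd) (simp only: j u_odd, simp add: algebra_simps)
  qed
  \<comment> \<open>The end of chord \<open>- 2 * k\<close> is listed as that of chord
    \<open>- 1 - 2 * (k + int n)\<close>, which is the same chord one period earlier.\<close>
  have u_chord: "\<phi> (cis (u j)) = cis (u (j + 2 * int n - 1))" if "odd j" for j
  proof -
    from that obtain k where j: "j = 2 * k + 1" by (rule oddE)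
    have "j + 2 * int n - 1 = 2 * (k + int n)" by (simp add: j)
    moreover have "- 1 - 2 * (k + int n) + (2 * int n + 1) = - 2 * k" by simp
    then have "a (- 2 * k) = a (- 1 - 2 * (k + int n)) + 2 * pi * of_int (int n)"
      using a_per[of "- 1 - 2 * (k + int n)"] by simp
    then have "next_end (a (- 2 * k)) = next_end (a (- 1 - 2 * (k + int n))) + 2 * pi * of_int (int n)"
      using next_end_shift by metis
    ultimately have "cis (u (j + 2 * int n - 1)) = cis (next_end (a (- 2 * k)))"
      by (simp only: u_even cis_add_int)
    also have "\<dots> = \<phi> (cis (a (- 2 * k)))" by (rule cis_next_end[OF a_lifts])
    also have "\<dots> = \<phi> (cis (u j))" by (simp only: j u_odd cis_add_int)
    finally show ?thesis ..
  qed
  have "u j \<in> lifts" for j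
    unfolding u_def using a_lifts next_end_in_lifts[OF a_lifts] by (simp only: lifts_shift_iff split: if_split) simp
  then have u_P: "cis (u j) \<in> P" for j unfolding lifts_def by blast
  obtain G :: "real \<Rightarrow> real" where G: "strict_mono G" "surj G" "\<And>k. G (of_int k) = u k"
    "\<And>y. G (y + of_int M) = G y + 2 * pi"
    using interpolation[of u M "2 * pi"] u_mono u_per by auto
  have injG: "inj G" using G(1) by (rule strict_mono_imp_inj_on)
  \<comment> \<open>Inverting \<open>G\<close> recovers the position in the list, rescaled so that
    \<open>u j\<close> goes to the angle of \<open>vertex n j\<close>.\<close>
  define g where "g t = 2 * pi * inv G t / of_int M" for t
  have gG: "g (G y) = 2 * pi * y / of_int M" for y by (simp add: g_def inv_f_f[OF injG])
  have "strict_mono g"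
  proof (rule strict_monoI)
    fix s t :: real assume "s < t"
    moreover obtain p q where "s = G p" "t = G q" using G(2) by (metis surjD)
    ultimately show "g s < g t" using G(1) M by (simp add: gG strict_mono_less divide_strict_right_mono)
  qed
  moreover have "surj g"
  proof (rule surjI)
    show "g (G (of_int M * t / (2 * pi))) = t" for t using M by (simp add: gG)
  qed
  moreover have "g (t + 2 * pi) = g t + 2 * pi" for t
  proof -
    obtain y where t: "t = G y" using G(2) by (metis surjD)
    show ?thesis unfolding t G(4)[symmetric] gG using M by (simp add: field_simps)
  qed
  ultimately obtain h where h: "orientation_preserving_homeo h" and hg: "\<And>t. h (cis t) = cis (g t)"
    using orientation_preserving_homeo_of_lift by blast
  have hu: "h (cis (u j)) = vertex n j" for j
  proof -
    have "h (cis (u j)) = cis (g (G (of_int j)))" by (simp only: hg G(3))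
    then show ?thesis by (simp only: gG vertex_def M_def)
  qed
  define Q where "Q = range (\<lambda>j. cis (u j))"
  have QP: "Q \<subseteq> P" using u_P by (auto simp: Q_def)
  have chord_cases: thesis if "x \<in> Q"
    "\<And>j. odd j \<Longrightarrow> x = cis (u j) \<Longrightarrow> thesis"
    "\<And>j. odd j \<Longrightarrow> x = cis (u (j + 2 * int n - 1)) \<Longrightarrow> thesis" for x thesis
  proof -
    obtain j where x: "x = cis (u j)" using \<open>x \<in> Q\<close> by (auto simp: Q_def)
    show thesis
    proof (cases "odd j")
      case False
      then show thesis using x that(3)[of "j - 2 * int n + 1"] by simp
    qed (use x that(2) in blast)
  qed
  have u_chord': "\<phi> (cis (u (j + 2 * int n - 1))) = cis (u j)" if "odd j" for j
    using u_chord[OF that] partner(3)[OF u_P[of j]] by simp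
  have \<phi>Q: "\<phi> x \<in> Q" if "x \<in> Q" for x
    using that by (rule chord_cases) (auto simp: u_chord u_chord' Q_def)
  have "is_chord_diagram (card Q div 2) (Q, \<phi>)"
  proof -
    have finQ: "finite Q" using QP points(2) finite_subset by blast
    have imQ: "h ` Q = range (vertex n)" by (auto simp: Q_def hu image_iff)
    have "inj_on h S1"
      using h by (auto simp: orientation_preserving_homeo_def homeomorphism_def intro: inj_on_inverseI)
    then have "inj_on h Q" by (rule inj_on_subset) (use QP points(1) in blast)
    then have "card Q = card (range (vertex n))" using imQ card_image by metis
    also have "\<dots> = 2 * (2 * n + 1)"
      using is_chord_diagram_odd_diagram[OF n] odd_diagram_points[OF n]
      by (auto simp: is_chord_diagram_def split: prod.splits)
    finally have "card Q = 2 * (2 * n + 1)" .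
    then show ?thesis
      using finQ QP points(1) \<phi>Q partner by (auto simp: is_chord_diagram_def)
  qed
  then have "sub_diagram (Q, \<phi>) (P, \<phi>)" using QP by (auto simp: sub_diagram_def)
  moreover have "equivalent_diagrams (Q, \<phi>) (odd_diagram n)"
  proof -
    have "h ` Q = fst (odd_diagram n)"
      unfolding odd_diagram_points[OF n] by (auto simp: Q_def hu image_iff)
    moreover have "h (\<phi> x) = snd (odd_diagram n) (h x)" if "x \<in> Q" for x
      using that by (rule chord_cases) (simp_all add: u_chord u_chord' hu odd_diagram_partner[OF n])
    ultimately show ?thesis
      unfolding equivalent_diagrams_def case_prod_beta using h by (intro exI[of _ h]) simp
  qed
  ultimately show ?thesis by blast
qed

end

theorem theorem1p1:
  fixes m :: nat and C :: diagram
  assumes "m \<ge> 1"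
    and "is_chord_diagram m C"
  shows "diagram_arc_number C = 2 \<longleftrightarrow>
    (\<forall>n\<ge>1. \<not> (\<exists>D. sub_diagram D C \<and> equivalent_diagrams D (odd_diagram n)))"
proof -
  obtain P \<phi> where C: "C = (P, \<phi>)" by (cases C)
  interpret chord_diagram P \<phi>
    using assms by unfold_locales (auto simp: C is_chord_diagram_def)
  show ?thesis
  proof
    assume "diagram_arc_number C = 2"
    then show "\<forall>n\<ge>1. \<not> (\<exists>D. sub_diagram D C \<and> equivalent_diagrams D (odd_diagram n))"
      unfolding C using no_odd_subdiagram by blast
  next
    assume none: "\<forall>n\<ge>1. \<not> (\<exists>D. sub_diagram D C \<and> equivalent_diagrams D (odd_diagram n))"
    show "diagram_arc_number C = 2"
    proof (rule ccontr)
      assume "diagram_arc_number C \<noteq> 2"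
      then obtain n a where "n \<ge> 1" "periodic_chain n a"
        "\<And>i. next_end (a i) < a (i + 1)" "\<And>i. a (i + 3) < next_end (a i) + 2 * pi"
        unfolding C using ex_tight_chain by blast
      then have "\<exists>D. sub_diagram D C \<and> equivalent_diagrams D (odd_diagram n)"
        unfolding C by (rule odd_subdiagram_of_chain)
      then show False using none \<open>n \<ge> 1\<close> by blast
    qed
  qed
qed

end
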